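(* Let $\mathbb{F}$ be a field and $n\ge 0$ an integer with $|\mathbb{F}| \geq 2n-1$. Let $V$ be an $\mathbb{F}$-vector space of dimension $2n$. Then the greatest possible dimension of an affine subspace of $\mathcal{A}^2(V)$ all of whose elements are symplectic forms is $n(n-1)$.
   Context: $\mathcal{A}^2(V)$ denotes the vector space of all alternating bilinear forms on $V$ (bilinear forms $b$ with $b(x,x)=0$ for all $x\in V$). A symplectic form is a non-degenerate alternating bilinear form. The field may have any characteristic, including 2. *)

theory Defs
  imports Complex_Main "HOL-Library.Function_Algebras"
begin

definition bilinear_form :: "('a::field \<Rightarrow> 'b::ab_group_add \<Rightarrow> 'b) \<Rightarrow> ('b \<Rightarrow> 'b \<Rightarrow> 'a) \<Rightarrow> bool" where
  "bilinear_form scale b \<longleftrightarrow>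
     (\<forall>x. Vector_Spaces.linear scale (*) (b x)) \<and> (\<forall>y. Vector_Spaces.linear scale (*) (\<lambda>x. b x y))"

definition alternating_form :: "('a::field \<Rightarrow> 'b::ab_group_add \<Rightarrow> 'b) \<Rightarrow> ('b \<Rightarrow> 'b \<Rightarrow> 'a) \<Rightarrow> bool" where
  "alternating_form scale b \<longleftrightarrow> bilinear_form scale b \<and> (\<forall>x. b x x = 0)"

definition symplectic_form :: "('a::field \<Rightarrow> 'b::ab_group_add \<Rightarrow> 'b) \<Rightarrow> ('b \<Rightarrow> 'b \<Rightarrow> 'a) \<Rightarrow> bool" where
  "symplectic_form scale b \<longleftrightarrow> alternating_form scale b \<and> (\<forall>x. (\<forall>y. b x y = 0) \<longrightarrow> x = 0)"

definition alt_forms :: "('a::field \<Rightarrow> 'b::ab_group_add \<Rightarrow> 'b) \<Rightarrow> ('b \<Rightarrow> 'b \<Rightarrow> 'a) set" where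
  "alt_forms scale = {b. alternating_form scale b}"

definition form_scale :: "'a::field \<Rightarrow> ('b \<Rightarrow> 'b \<Rightarrow> 'a) \<Rightarrow> ('b \<Rightarrow> 'b \<Rightarrow> 'a)" where
  "form_scale c f = (\<lambda>x y. c * f x y)"

definition affine_subspace_of_dim ::
  "('a::field \<Rightarrow> 'b::ab_group_add \<Rightarrow> 'b) \<Rightarrow> ('b \<Rightarrow> 'b \<Rightarrow> 'a) set \<Rightarrow> nat \<Rightarrow> bool" where
  "affine_subspace_of_dim scale S d \<longleftrightarrow>
     (\<exists>b0 W. b0 \<in> alt_forms scale \<and> W \<subseteq> alt_forms scale \<and>
        module.subspace form_scale W \<and> S = (\<lambda>w. b0 + w) ` W \<and>
        vector_space.dim form_scale W = d)"

end

theory Submission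
  imports Defs
begin

text \<open>
  Upper bound, for \<open>P + W\<close> consisting of symplectic forms: induction on \<open>n\<close>. Fix \<open>x \<noteq> 0\<close>, choose
  \<open>b\<close> with \<open>P x b = 1\<close> and let \<open>U'\<close> be the \<open>P\<close>-orthogonal complement of the plane spanned by \<open>x\<close>
  and \<open>b\<close>. The forms \<open>w \<in> W\<close> with \<open>w x = 0\<close> restrict to \<open>U'\<close> and the induction hypothesis applies
  to them; those that vanish on \<open>U'\<close> are the wedges of \<open>P x\<close> and \<open>P y\<close> with \<open>y\<close> in
  some subspace \<open>Y\<close> of \<open>U'\<close>. It remains to see that the functionals \<open>w x\<close> take up at most
  \<open>2n - 2 - dim Y\<close> dimensions, and this follows from \<open>w x y = 0\<close> for all \<open>w \<in> W\<close> and \<open>y \<in> Y\<close>, together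
  with the fact that \<open>w x\<close> is never a nonzero multiple of \<open>P x\<close>.

  For the orthogonality relation let \<open>z t\<close> be the solution of \<open>(P + t w) (z t) = P x\<close>. Perturbing \<open>P + t w\<close>
  by multiples of the wedge of \<open>P x\<close> and \<open>P y\<close> shows \<open>P (z t) y = 0\<close>, and \<open>P (z t) x = 0\<close> always holds.
  If \<open>w x y \<noteq> 0\<close>, the vectors \<open>z t\<close>, with \<open>t\<close> ranging over the field, are linearly independent, and
  so the field has at most \<open>2n - 2\<close> elements.

  The bound is attained by the forms whose Gram matrix vanishes above the antidiagonal and has
  fixed entries \<open>1\<close> and \<open>-1\<close> on it.
\<close>

section \<open>Calculus of alternating bilinear forms\<close>

lemma alternating_form_linear:
  assumes "alternating_form scale b"
  shows "Vector_Spaces.linear scale (*) (\<lambda>x. b x y)" "Vector_Spaces.linear scale (*) (b x)"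
  using assms by (auto simp: alternating_form_def bilinear_form_def)

lemma alternating_formD:
  assumes "alternating_form scale b"
  shows "b (x + y) z = b x z + b y z" "b z (x + y) = b z x + b z y"
    "b (scale c x) y = c * b x y" "b x (scale c y) = c * b x y"
    "b (x - y) z = b x z - b y z" "b z (x - y) = b z x - b z y"
    "b 0 x = 0" "b x 0 = 0" "b x x = 0"
    "b (sum g I) y = (\<Sum>i\<in>I. b (g i) y)" "b y (sum g I) = (\<Sum>i\<in>I. b y (g i))"
proof -
  note L = alternating_form_linear[OF assms, folded module_hom_iff_linear]
  show "b (x + y) z = b x z + b y z" "b z (x + y) = b z x + b z y"
    "b (scale c x) y = c * b x y" "b x (scale c y) = c * b x y"
    "b (x - y) z = b x z - b y z" "b z (x - y) = b z x - b z y"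
    "b 0 x = 0" "b x 0 = 0"
    "b (sum g I) y = (\<Sum>i\<in>I. b (g i) y)" "b y (sum g I) = (\<Sum>i\<in>I. b y (g i))"
    using L[THEN module_hom.add] L[THEN module_hom.scale] L[THEN module_hom.diff]
      L[THEN module_hom.zero] L[THEN module_hom.sum] by simp_all
  show "b x x = 0" using assms by (simp add: alternating_form_def)
qed

lemma alternating_form_swap:
  assumes "alternating_form scale b"
  shows "b y x = - b x y"
proof -
  have "b (x + y) (x + y) = 0" "b x x = 0" "b y y = 0"
    using assms by (simp_all add: alternating_formD(9))
  then have "b x y + b y x = 0"
    by (simp add: alternating_formD(1,2)[OF assms] add.commute)
  then show ?thesis by (simp add: add_eq_0_iff)
qed

lemma alternating_formI:
  assumes "vector_space scale"
    and "\<And>x y z. b (x + y) z = b x z + b y z" "\<And>x y z. b z (x + y) = b z x + b z y"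
    and "\<And>c x y. b (scale c x) y = c * b x y" "\<And>c x y. b x (scale c y) = c * b x y"
    and "\<And>x. b x x = 0"
  shows "alternating_form scale b"
proof -
  have "vector_space ((*) :: 'a::field \<Rightarrow> 'a \<Rightarrow> 'a)"
    by unfold_locales (auto simp: algebra_simps)
  with assms show ?thesis
    by (auto simp: alternating_form_def bilinear_form_def Vector_Spaces.linear_iff)
qed

section \<open>The vector space of forms\<close>

lemma form_scale_apply: "form_scale c f x y = c * f x y"
  by (simp add: form_scale_def)

interpretation forms: vector_space form_scale
  by unfold_locales (auto simp: form_scale_def fun_eq_iff algebra_simps)

lemma subspace_alt_forms:
  assumes "vector_space scale"
  shows "forms.subspace (alt_forms scale)"
proof (rule forms.subspaceI)
  show "0 \<in> alt_forms scale"
    by (auto simp: alt_forms_def intro!: alternating_formI assms)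
  fix f g :: "'b \<Rightarrow> 'b \<Rightarrow> 'a" and c :: 'a
  assume f: "f \<in> alt_forms scale"
  then have f: "alternating_form scale f" by (simp add: alt_forms_def)
  show "form_scale c f \<in> alt_forms scale"
    unfolding alt_forms_def mem_Collect_eq
    by (rule alternating_formI) (auto simp: assms form_scale_def alternating_formD[OF f] algebra_simps)
  assume g: "g \<in> alt_forms scale"
  then have g: "alternating_form scale g" by (simp add: alt_forms_def)
  show "f + g \<in> alt_forms scale"
    unfolding alt_forms_def mem_Collect_eq
    by (rule alternating_formI) (auto simp: assms alternating_formD[OF f] alternating_formD[OF g] algebra_simps)
qed

text \<open>Relative to a set \<open>U\<close>, so that the induction can descend to subspaces while
  all forms stay defined on the whole type.\<close>

definition nondegenerate_on :: "'b::zero set \<Rightarrow> ('b \<Rightarrow> 'b \<Rightarrow> 'a::zero) \<Rightarrow> bool" where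
  "nondegenerate_on U b \<longleftrightarrow> (\<forall>x\<in>U. (\<forall>y\<in>U. b x y = 0) \<longrightarrow> x = 0)"

lemma nondegenerate_onD:
  "nondegenerate_on U b \<Longrightarrow> x \<in> U \<Longrightarrow> (\<And>y. y \<in> U \<Longrightarrow> b x y = 0) \<Longrightarrow> x = 0"
  by (auto simp: nondegenerate_on_def)

section \<open>Bounding a dimension by separating functionals\<close>

context vector_space
begin

text \<open>Each functional costs at most one generator: if \<open>f j w0\<close> is nonzero, every
  element of \<open>W\<close> is a multiple of \<open>w0\<close> modulo the kernel of
  \<open>f j\<close>. The induction carries a finite spanning set instead of a bound on
  \<open>dim\<close>, as the ambient space may be infinite-dimensional; this is the case for the
  space of all functions in two variables.\<close>

lemma dim_le_card_separating:
  assumes "finite I" "\<And>i. i \<in> I \<Longrightarrow> Vector_Spaces.linear scale (*) (f i)" "subspace W"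
    and "\<And>w. w \<in> W \<Longrightarrow> (\<And>i. i \<in> I \<Longrightarrow> f i w = 0) \<Longrightarrow> w = 0"
  shows "dim W \<le> card I"
proof -
  have "\<exists>S. finite S \<and> card S \<le> card I \<and> W \<subseteq> span S"
    using assms
  proof (induction I arbitrary: W rule: finite_induct)
    case empty
    then have "W \<subseteq> span {}" by auto
    then show ?case by (intro exI[of _ "{}"]) simp
  next
    case (insert j I)
    have add: "f j (u + v) = f j u + f j v" and sc: "f j (scale c u) = c * f j u" for u v c
      using insert.prems(1)[of j] by (auto simp: Vector_Spaces.linear_iff)
    have z: "f j 0 = 0" using sc[of 0 0] by simp
    define W0 where "W0 = {w \<in> W. f j w = 0}"
    have "subspace W0" using insert.prems(2) by (auto simp: W0_def subspace_def add sc z)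
    moreover have "w = 0" if "w \<in> W0" "\<And>i. i \<in> I \<Longrightarrow> f i w = 0" for w
      using insert.prems(3)[of w] that by (auto simp: W0_def)
    ultimately obtain S where S: "finite S" "card S \<le> card I" "W0 \<subseteq> span S"
      using insert.IH[of W0] insert.prems(1) by auto
    show ?case
    proof (cases "\<exists>w\<in>W. f j w \<noteq> 0")
      case True
      then obtain w0 where w0: "w0 \<in> W" "f j w0 \<noteq> 0" by blast
      have "w \<in> span (insert w0 S)" if "w \<in> W" for w
      proof -
        have "w + scale (- (f j w / f j w0)) w0 \<in> W0"
          using that w0 insert.prems(2) unfolding W0_def mem_Collect_eq add sc
          by (intro conjI subspace_add subspace_scale) auto
        then show ?thesis using S(3) unfolding span_breakdown_eq
          by (intro exI[of _ "f j w / f j w0"]) auto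
      qed
      moreover have "card (insert w0 S) \<le> card (insert j I)"
        using S insert.hyps by (simp add: card_insert_if)
      ultimately show ?thesis using S(1) by (intro exI[of _ "insert w0 S"]) auto
    next
      case False
      then have "W \<subseteq> W0" by (auto simp: W0_def)
      then show ?thesis using S insert.hyps by (intro exI[of _ S]) auto
    qed
  qed
  then show ?thesis by (meson dim_le_card le_trans)
qed

end

lemma sum_form_apply: "(sum h A :: 'b \<Rightarrow> 'b \<Rightarrow> 'a::comm_monoid_add) u v = (\<Sum>a\<in>A. h a u v)"
  by (induction A rule: infinite_finite_induct) auto

section \<open>Representing functionals by a nondegenerate form\<close>

context finite_dimensional_vector_space
begin

lemma linear_eq_on_span:
  assumes "Vector_Spaces.linear scale (*) f" "Vector_Spaces.linear scale (*) g"
    and "v \<in> span B" "\<And>b. b \<in> B \<Longrightarrow> f b = g b"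
  shows "f v = g v"
proof -
  interpret vector_space_pair scale "(*) :: 'a \<Rightarrow> 'a \<Rightarrow> 'a"
    using assms(1) by (auto simp: Vector_Spaces.linear_iff vector_space_pair_def)
  show ?thesis using linear_eq_on[OF assms(1-3)] assms(4) by blast
qed

text \<open>The map \<open>T\<close> uses the values of \<open>b z\<close> on the basis as
  coordinates. Nondegeneracy makes it an injective endomorphism of \<open>U\<close>, so it is onto
  by dimension.\<close>

lemma nondegenerate_on_surj_basis:
  assumes b: "alternating_form scale b" and U: "nondegenerate_on U b"
    and B: "B \<subseteq> U" "independent B" "span B = U"
  shows "\<exists>z\<in>U. \<forall>d\<in>B. b z d = f d"
proof -
  interpret fp: finite_dimensional_vector_space_pair_1 scale Basis scale ..
  have fin: "finite B" using B by (simp add: finiteI_independent)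
  define T where "T z = (\<Sum>d\<in>B. scale (b z d) d)" for z
  have lin: "Vector_Spaces.linear scale scale T"
    by (auto simp: Vector_Spaces.linear_iff T_def alternating_formD[OF b] scale_left_distrib
        sum.distrib scale_sum_right intro: vector_space_axioms)
  have sU: "subspace U" using B(3) subspace_span by blast
  have coeff: "g d = 0" if "(\<Sum>d\<in>B. scale (g d) d) = 0" "d \<in> B" for g d
    using independentD[OF B(2) fin subset_refl] that by blast
  have "inj_on T (span U)"
  proof (rule inj_onI)
    fix v w assume vw: "v \<in> span U" "w \<in> span U" "T v = T w"
    then have U': "v - w \<in> U" using sU by (simp add: span_eq_iff[THEN iffD2] subspace_diff)
    have "(\<Sum>d\<in>B. scale (b (v - w) d) d) = 0"
      using vw(3) by (simp add: T_def alternating_formD[OF b] scale_left_diff_distrib sum_subtractf)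
    then have "b (v - w) d = 0" if "d \<in> B" for d using coeff that by blast
    then have "b (v - w) y = 0" if "y \<in> U" for y
      using linear_eq_on_span[OF alternating_form_linear(2)[OF b]
          alternating_form_linear(2)[OF b], of y B "v - w" 0] that B(3)
      by (simp add: alternating_formD[OF b])
    then have "v - w = 0" by (rule nondegenerate_onD[OF U U'])
    then show "v = w" by simp
  qed
  then have "dim (T ` U) = dim U" using fp.dim_image_eq[OF lin] by blast
  moreover have "T ` U \<subseteq> U" 
    unfolding T_def using B(1) by (blast intro: subspace_sum[OF sU] subspace_scale[OF sU])
  moreover have "subspace (T ` U)"
    using lin sU by (simp add: module_hom.subspace_image module_hom_iff_linear)
  ultimately have "T ` U = U" using subspace_dim_equal[OF _ sU] by simp
  moreover have "(\<Sum>d\<in>B. scale (f d) d) \<in> U"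
    using B(1) by (blast intro: subspace_sum[OF sU] subspace_scale[OF sU])
  ultimately obtain z where z: "z \<in> U" "T z = (\<Sum>d\<in>B. scale (f d) d)" by (metis imageE)
  then have "(\<Sum>d\<in>B. scale (b z d - f d) d) = 0"
    by (simp add: T_def scale_left_diff_distrib sum_subtractf)
  then have "b z d = f d" if "d \<in> B" for d
    using coeff[of "\<lambda>d. b z d - f d"] that by auto
  then show ?thesis using z(1) by blast
qed

lemma nondegenerate_on_surj:
  assumes b: "alternating_form scale b" and U: "nondegenerate_on U b" "subspace U"
    and f: "Vector_Spaces.linear scale (*) f"
  shows "\<exists>z\<in>U. \<forall>v\<in>U. b z v = f v"
proof -
  obtain B where B: "B \<subseteq> U" "independent B" "U \<subseteq> span B" using basis_exists by metis
  then have sp: "span B = U" using U(2) by (simp add: span_subspace)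
  obtain z where "z \<in> U" "\<forall>d\<in>B. b z d = f d"
    using nondegenerate_on_surj_basis[OF b U(1) B(1,2) sp] by blast
  then show ?thesis
    using linear_eq_on_span[OF alternating_form_linear(2)[OF b] f] sp by blast
qed

section \<open>Linear independence of the resolvents \<open>z t\<close>\<close>

context
  fixes P w :: "'b \<Rightarrow> 'b \<Rightarrow> 'a" and U :: "'b set" and x y :: 'b and z :: "'a \<Rightarrow> 'b"
  assumes P: "alternating_form scale P" and w: "alternating_form scale w"
    and U: "subspace U" and nd: "nondegenerate_on U P"
    and x: "x \<in> U" and y: "y \<in> U" and Pxy: "P x y = 0" and wxy: "w x y \<noteq> 0"
    and z: "\<And>t. z t \<in> U" and Pzy: "\<And>t. P (z t) y = 0"
    and z_eq: "\<And>t v. v \<in> U \<Longrightarrow> P (z t) v + t * w (z t) v = P x v"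
begin

text \<open>Apply \<open>w\<close> to the relation and replace \<open>w (z t)\<close> by
  \<open>(P x - P (z t)) / t\<close> on \<open>U\<close>. At \<open>y\<close> only
  \<open>e * w x y\<close> survives, so \<open>e = 0\<close>. Nondegeneracy of \<open>P\<close> then
  turns the remaining identity into a relation among the vectors \<open>x - z t\<close> with
  coefficients \<open>c t / t\<close>.\<close>

lemma resolvent_relation:
  assumes "finite T" "0 \<notin> T" and rel: "scale e x + (\<Sum>t\<in>T. scale (c t) (z t)) = 0"
  shows "e = 0" "(\<Sum>t\<in>T. scale (c t / t) (z t)) = 0"
proof -
  have wz: "w (z t) v = (P x v - P (z t) v) / t" if "t \<in> T" "v \<in> U" for t v
  proof -
    have "t \<noteq> 0" using that assms(2) by auto
    then show ?thesis using z_eq[OF that(2), of t] by (simp add: field_simps)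
  qed
  have *: "e * w x v + (\<Sum>t\<in>T. c t / t * (P x v - P (z t) v)) = 0"
    if "v \<in> U" "scale e x + (\<Sum>t\<in>T. scale (c t) (z t)) = 0" for v e c
  proof -
    have "0 = w (scale e x + (\<Sum>t\<in>T. scale (c t) (z t))) v"
      unfolding that(2) by (simp add: alternating_formD[OF w])
    also have "\<dots> = e * w x v + (\<Sum>t\<in>T. c t * w (z t) v)"
      by (simp add: alternating_formD[OF w])
    also have "(\<Sum>t\<in>T. c t * w (z t) v) = (\<Sum>t\<in>T. c t / t * (P x v - P (z t) v))"
      using that(1) by (intro sum.cong) (auto simp: wz)
    finally show ?thesis by simp
  qed
  \<comment> \<open>Kept general in \<open>e\<close> and \<open>c\<close>: it is applied once to the
    given relation and once to the derived relation \<open>rel'\<close>, where it removes the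
    multiple of \<open>x\<close>.\<close>
  have e0: "e = 0" if "scale e x + (\<Sum>t\<in>T. scale (c t) (z t)) = 0" for e c
    using *[OF y that] wxy by (simp add: Pxy Pzy)
  show "e = 0" using e0 rel by blast
  define s where "s = (\<Sum>t\<in>T. scale (c t / t) (x - z t))"
  have "s \<in> U" unfolding s_def
    by (intro subspace_sum[OF U] subspace_scale[OF U] subspace_diff[OF U] x z)
  moreover have "P s v = 0" if "v \<in> U" for v
    using *[OF that rel] \<open>e = 0\<close> by (simp add: s_def alternating_formD[OF P])
  ultimately have "s = 0" by (rule nondegenerate_onD[OF nd])
  then have rel': "scale (- (\<Sum>t\<in>T. c t / t)) x + (\<Sum>t\<in>T. scale (c t / t) (z t)) = 0"
    by (simp add: s_def scale_right_diff_distrib sum_subtractf scale_sum_left)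
  from e0[OF rel'] rel' show "(\<Sum>t\<in>T. scale (c t / t) (z t)) = 0" by simp
qed

lemma resolvent_0: "z 0 = x"
proof -
  have "z 0 - x = 0"
    by (rule nondegenerate_onD[OF nd subspace_diff[OF U z x]])
      (use z_eq[of _ 0] in \<open>simp add: alternating_formD[OF P]\<close>)
  then show ?thesis by simp
qed

lemma resolvent_nonzero: "z t \<noteq> 0"
proof
  assume 0: "z t = 0"
  have "x = 0"
    by (rule nondegenerate_onD[OF nd x])
      (use z_eq[of _ t] in \<open>simp add: 0 alternating_formD[OF P] alternating_formD[OF w]\<close>)
  then show False using wxy by (simp add: alternating_formD[OF w])
qed

text \<open>As for eigenvectors with distinct eigenvalues: dividing each coefficient by its own
  \<open>t\<close> gives a relation again, and comparing it with the original relation divided by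
  \<open>s\<close> eliminates \<open>z s\<close>.\<close>

lemma resolvents_coeff_nonzero_parameters:
  assumes "finite T" "0 \<notin> T" "(\<Sum>t\<in>T. scale (c t) (z t)) = 0"
  shows "\<forall>t\<in>T. c t = 0"
  using assms
proof (induction T arbitrary: c rule: finite_induct)
  case (insert s T)
  have "s \<noteq> 0" using insert.prems(1) by auto
  have r1: "scale (c s) (z s) + (\<Sum>t\<in>T. scale (c t) (z t)) = 0"
    using insert by simp
  have "(\<Sum>t\<in>insert s T. scale (c t / t) (z t)) = 0"
    by (rule resolvent_relation(2)[of _ 0]) (use insert in auto)
  then have r2: "scale (c s / s) (z s) + (\<Sum>t\<in>T. scale (c t / t) (z t)) = 0"
    using insert.hyps by simp
  have "scale (1 / s) (scale (c s) (z s) + (\<Sum>t\<in>T. scale (c t) (z t))) = 0"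
    unfolding r1 by simp
  then have "scale (c s / s) (z s) + (\<Sum>t\<in>T. scale (c t / s) (z t)) = 0"
    by (simp add: scale_right_distrib scale_sum_right)
  with r2 have "(\<Sum>t\<in>T. scale (c t / t) (z t)) = (\<Sum>t\<in>T. scale (c t / s) (z t))"
    by (metis add_left_cancel)
  then have "(\<Sum>t\<in>T. scale (c t / t - c t / s) (z t)) = 0"
    by (simp add: scale_left_diff_distrib sum_subtractf)
  then have d: "\<forall>t\<in>T. c t / t - c t / s = 0"
    using insert.IH[of "\<lambda>t. c t / t - c t / s"] insert.prems(1) by blast
  have T0: "c t = 0" if "t \<in> T" for t
  proof -
    have "t \<noteq> 0" "t \<noteq> s" using that insert.prems(1) insert.hyps(2) by auto
    moreover have "c t * (s - t) = 0"
      using d that \<open>s \<noteq> 0\<close> \<open>t \<noteq> 0\<close> by (auto simp: field_simps)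
    ultimately show ?thesis by simp
  qed
  then have "scale (c s) (z s) = 0" using r1 by simp
  then show ?case using T0 resolvent_nonzero by simp
qed simp

text \<open>The parameter \<open>0\<close> contributes \<open>z 0 = x\<close>, whose coefficient in
  such a relation vanishes by \<open>resolvent_relation\<close>.\<close>

lemma resolvents_coeff:
  assumes "finite T" "(\<Sum>t\<in>T. scale (c t) (z t)) = 0" "t \<in> T"
  shows "c t = 0"
proof -
  have c0: "c 0 = 0" if "0 \<in> T"
  proof (rule resolvent_relation(1))
    show "scale (c 0) x + (\<Sum>t\<in>T - {0}. scale (c t) (z t)) = 0"
      using sum.remove[OF assms(1) that, of "\<lambda>t. scale (c t) (z t)"] assms(2)
      by (simp add: resolvent_0)
  qed (use assms in auto)
  have "(\<Sum>t\<in>T - {0}. scale (c t) (z t)) = (\<Sum>t\<in>T. scale (c t) (z t))"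
    by (rule sum.mono_neutral_left) (use assms(1) c0 in auto)
  then have "\<forall>t\<in>T - {0}. c t = 0"
    by (intro resolvents_coeff_nonzero_parameters) (use assms in auto)
  then show ?thesis using c0 assms(3) by (cases "t = 0") auto
qed

lemma card_le_dim_resolvents:
  assumes T: "finite (T :: 'a set)"
  shows "card T \<le> dim {v \<in> U. P v x = 0 \<and> P v y = 0}"
proof -
  have inj: "inj_on z T"
  proof (rule inj_onI, rule ccontr)
    fix s t assume st: "s \<in> T" "t \<in> T" "z s = z t" "s \<noteq> t"
    define c where "c r = (if r = s then 1 else - 1 :: 'a)" for r
    have "c s = 0"
      by (rule resolvents_coeff[of "{s, t}"]) (use st in \<open>auto simp: c_def\<close>)
    then show False by (simp add: c_def)
  qed
  have "independent (z ` T)"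
  proof (rule independent_if_scalars_zero)
    fix f v assume "(\<Sum>v\<in>z ` T. scale (f v) v) = 0" and v: "v \<in> z ` T"
    then have "(\<Sum>t\<in>T. scale (f (z t)) (z t)) = 0"
      by (simp add: sum.reindex[OF inj])
    then show "f v = 0" using resolvents_coeff[OF T, of "\<lambda>t. f (z t)"] v by auto
  qed (use T in simp)
  \<comment> \<open>The defining equation is evaluated at \<open>z t\<close> itself, where both
    forms on the left vanish.\<close>
  moreover have "P (z t) x = 0" for t
    using z_eq[OF z, of t t] alternating_form_swap[OF P, of "z t" x]
    by (simp add: alternating_formD[OF P] alternating_formD[OF w])
  then have "z ` T \<subseteq> {v \<in> U. P v x = 0 \<and> P v y = 0}" using z Pzy by auto
  ultimately have "card (z ` T) \<le> dim {v \<in> U. P v x = 0 \<and> P v y = 0}"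
    by (metis independent_card_le_dim)
  then show ?thesis by (simp add: card_image[OF inj])
qed

end

text \<open>If \<open>w x y\<close> were nonzero, the resolvents for all scalars would be
  independent vectors \<open>P\<close>-orthogonal to \<open>x\<close> and \<open>y\<close>. The
  vectors \<open>b\<close> and \<open>d\<close> show that each of these two conditions cuts down the
  dimension, leaving at most \<open>dim U - 2\<close>, fewer than the number of scalars.\<close>

lemma isotropic_resolvents_imp_orthogonal:
  assumes P: "alternating_form scale P" and w: "alternating_form scale w"
    and U: "subspace U" and nd: "\<And>t. nondegenerate_on U (P + form_scale t w)"
    and xy: "x \<in> U" "y \<in> U" "P x y = 0"
    and b: "b \<in> U" "P b x \<noteq> 0" and d: "d \<in> U" "P d x = 0" "P d y \<noteq> 0"
    and iso: "\<And>t z. z \<in> U \<Longrightarrow> (\<And>v. v \<in> U \<Longrightarrow> P z v + t * w z v = P x v) \<Longrightarrow> P z y = 0"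
    and field: "infinite (UNIV :: 'a set) \<or> dim U - 1 \<le> card (UNIV :: 'a set)"
  shows "w x y = 0"
proof (rule ccontr)
  assume wxy: "w x y \<noteq> 0"
  have vs: "vector_space scale" by unfold_locales
  have "\<exists>z\<in>U. \<forall>v\<in>U. P z v + t * w z v = P x v" for t
  proof -
    have "alternating_form scale (P + form_scale t w)"
      by (rule alternating_formI[OF vs])
        (auto simp: form_scale_def alternating_formD[OF P] alternating_formD[OF w] algebra_simps)
    from nondegenerate_on_surj[OF this nd U alternating_form_linear(2)[OF P]]
    show ?thesis by (simp add: form_scale_def)
  qed
  then obtain z where z: "\<And>t. z t \<in> U" "\<And>t v. v \<in> U \<Longrightarrow> P (z t) v + t * w (z t) v = P x v"
    by metis
  have zy: "P (z t) y = 0" for t using iso z by blast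
  have nd0: "nondegenerate_on U P" using nd[of 0] by (simp add: form_scale_def plus_fun_def)
  let ?K1 = "{v \<in> U. P v x = 0}" and ?K2 = "{v \<in> U. P v x = 0 \<and> P v y = 0}"
  have "subspace ?K1" "subspace ?K2"
    using U by (auto simp: subspace_def alternating_formD[OF P])
  moreover have "?K1 \<subset> U" "?K2 \<subset> ?K1" using b d by auto
  ultimately have "dim ?K2 < dim ?K1" "dim ?K1 < dim U"
    using U by (auto intro!: dim_psubset simp: span_eq_iff[THEN iffD2])
  moreover have card: "card T \<le> dim ?K2" if "finite T" for T :: "'a set"
    by (rule card_le_dim_resolvents[OF P w U nd0 xy wxy z(1) zy z(2) that])
  ultimately have le: "card T < dim U - 1" if "finite T" for T :: "'a set"
    using that by fastforce
  \<comment> \<open>A finite field could itself serve as \<open>T\<close>, against the assumed bound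
    on its size.\<close>
  have "infinite (UNIV :: 'a set)" using le[of UNIV] field by force
  then obtain T :: "'a set" where "finite T" "card T = dim U"
    using infinite_arbitrarily_large by metis
  then show False using le by fastforce
qed

text \<open>Since \<open>P x z = Q z z = 0\<close>, the wedge satisfies
  \<open>w z v = P z y * P x v\<close>. If \<open>P z y\<close> is nonzero, the scalar
  \<open>- 1 / P z y\<close> makes the perturbed form cancel \<open>Q z = P x\<close>, which puts
  \<open>z\<close> into its radical.\<close>

lemma wedge_perturbation_isotropic:
  assumes Q: "alternating_form scale Q"
    and nd: "\<And>s. nondegenerate_on U (Q + form_scale s w)"
    and w: "\<And>u v. u \<in> U \<Longrightarrow> v \<in> U \<Longrightarrow> w u v = P x u * P y v - P y u * P x v"
    and P: "alternating_form scale P"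
    and z: "z \<in> U" "\<And>v. v \<in> U \<Longrightarrow> Q z v = P x v"
  shows "P z y = 0"
proof (rule ccontr)
  assume Pzy: "P z y \<noteq> 0"
  have Pxz: "P x z = 0" using z(2)[OF z(1)] by (simp add: alternating_formD[OF Q])
  have Pyz: "P y z = - P z y" by (rule alternating_form_swap[OF P])
  have "z = 0"
  proof (rule nondegenerate_onD[OF nd[of "- 1 / P z y"] z(1)])
    fix v assume "v \<in> U"
    then show "(Q + form_scale (- 1 / P z y) w) z v = 0"
      using Pzy by (simp add: form_scale_def z(2) w[OF z(1)] Pxz Pyz)
  qed
  then show False using Pzy by (simp add: alternating_formD[OF P])
qed

section \<open>The induction for the upper bound\<close>

text \<open>The second claim is the projection onto \<open>U'\<close> along the plane of
  \<open>x\<close> and \<open>b\<close>; its signs come from \<open>P x b = 1\<close> and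
  \<open>P b x = - 1\<close>.\<close>

lemma hyperbolic_plane_complement:
  assumes P: "alternating_form scale P" and U: "subspace U"
    and x: "x \<in> U" and b: "b \<in> U" and Pxb: "P x b = 1"
  defines "U' \<equiv> {v \<in> U. P x v = 0 \<and> P b v = 0}"
  shows "subspace U'" "\<And>v. v \<in> U \<Longrightarrow> v + scale (P b v) x - scale (P x v) b \<in> U'"
    "dim U = dim U' + 2"
proof -
  show sU': "subspace U'"
    using U by (auto simp: U'_def subspace_def alternating_formD[OF P])
  have Pbx: "P b x = - 1" using alternating_form_swap[OF P, of b x] Pxb by simp
  show dec: "v + scale (P b v) x - scale (P x v) b \<in> U'" if "v \<in> U" for v
    using that x b
    by (auto simp: U'_def alternating_formD[OF P] Pxb Pbx
        intro!: subspace_add[OF U] subspace_diff[OF U] subspace_scale[OF U])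
  have spU': "span U' = U'" using sU' by simp
  have "b \<notin> U'" using Pxb by (simp add: U'_def)
  moreover have "x \<notin> span (insert b U')"
  proof
    assume "x \<in> span (insert b U')"
    then obtain k where k: "x - scale k b \<in> U'" by (auto simp: span_breakdown_eq spU')
    then have "P x (x - scale k b) = 0" by (simp add: U'_def)
    then have "k = 0" by (simp add: alternating_formD[OF P] Pxb)
    with k have "P b x = 0" by (simp add: U'_def)
    then show False by (simp add: Pbx)
  qed
  ultimately have d: "dim (insert x (insert b U')) = dim U' + 2"
    by (simp add: dim_insert spU')
  have "v \<in> span (insert x (insert b U'))" if "v \<in> U" for v
  proof -
    have "v = (v + scale (P b v) x - scale (P x v) b) - scale (P b v) x + scale (P x v) b" by simp
    also have "\<dots> \<in> span (insert x (insert b U'))"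
      by (rule span_add[OF span_diff[OF span_base span_scale[OF span_base]] span_scale[OF span_base]])
        (use dec[OF that] in auto)
    finally show ?thesis .
  qed
  then have "dim U \<le> dim (insert x (insert b U'))" by (intro dim_mono) auto
  moreover have "dim (insert x (insert b U')) \<le> dim U"
    by (rule dim_subset) (use x b in \<open>auto simp: U'_def\<close>)
  ultimately show "dim U = dim U' + 2" using d by simp
qed

text \<open>The bound is stated through evaluations at pairs of vectors because the forms live on
  the whole space while only their restrictions to \<open>U\<close> count; this avoids a dimension
  for the space of restrictions. Passing from \<open>n\<close> to \<open>Suc n\<close> adds
  \<open>2 * n\<close> pairs.\<close>

lemma symplectic_affine_space_separating_pairs:
  assumes field: "infinite (UNIV :: 'a set) \<or> 2 * n - 1 \<le> card (UNIV :: 'a set)"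
    and P: "alternating_form scale P"
    and "subspace U" "dim U = 2 * n" "W \<subseteq> alt_forms scale" "forms.subspace W"
    and "\<And>w. w \<in> W \<Longrightarrow> nondegenerate_on U (P + w)"
  shows "\<exists>E. finite E \<and> card E \<le> n * (n - 1) \<and>
    (\<forall>w\<in>W. (\<forall>(p, q)\<in>E. w p q = 0) \<longrightarrow> (\<forall>u\<in>U. \<forall>v\<in>U. w u v = 0))"
  using assms
proof (induction n arbitrary: U W)
  case 0
  then have "U \<subseteq> {0}" by simp
  then have "w u v = 0" if "w \<in> W" "u \<in> U" for w u v
    using 0(5) that alternating_formD(7)[of scale w v] by (auto simp: alt_forms_def)
  then show ?case by (intro exI[of _ "{}"]) simp
next
  case (Suc n)
  note U = Suc.prems(3) and dimU = Suc.prems(4) and nd = Suc.prems(7) and sW = Suc.prems(6)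
  have vs: "vector_space scale" by unfold_locales
  have alt: "alternating_form scale w" if "w \<in> W" for w
    using Suc.prems(5) that by (auto simp: alt_forms_def)
  have ndP: "nondegenerate_on U P"
    using nd[OF forms.subspace_0[OF sW]] by simp
  have "\<not> U \<subseteq> {0}" using dimU dim_eq_0[of U] by auto
  then obtain x where x: "x \<in> U" "x \<noteq> 0" by auto
  then obtain b0 where b0: "b0 \<in> U" "P x b0 \<noteq> 0" using nondegenerate_onD[OF ndP] by blast
  define b where "b = scale (1 / P x b0) b0"
  have b: "b \<in> U" and Pxb: "P x b = 1"
    using b0 by (auto simp: b_def alternating_formD[OF P] subspace_scale[OF U])
  have Pbx: "P b x = - 1" using alternating_form_swap[OF P, of b x] Pxb by simp
  define U' where "U' = {v \<in> U. P x v = 0 \<and> P b v = 0}"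
  note hyp = hyperbolic_plane_complement[OF P U x(1) b Pxb, folded U'_def]
  have U'U: "U' \<subseteq> U" by (auto simp: U'_def)
  have dimU': "dim U' = 2 * n" using hyp(3) dimU by simp
  define W' where "W' = {w \<in> W. \<forall>v\<in>U. w x v = 0}"
  have sW': "forms.subspace W'"
    using sW unfolding forms.subspace_def by (auto simp: W'_def form_scale_apply)
  have ndU': "nondegenerate_on U' (P + w)" if w: "w \<in> W'" for w
    unfolding nondegenerate_on_def
  proof (intro ballI impI)
    fix v assume v: "v \<in> U'" "\<forall>y\<in>U'. (P + w) v y = 0"
    have wW: "w \<in> W" and wx: "\<And>y. y \<in> U \<Longrightarrow> w x y = 0" using w by (auto simp: W'_def)
    note aw = alternating_formD[OF alt[OF wW]]
    \<comment> \<open>On \<open>U'\<close> and at \<open>x\<close> the vector \<open>v\<close>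
      already pairs to zero; as \<open>P x b = 1\<close> and \<open>w x b = 0\<close>, this multiple
      of \<open>x\<close> also cancels the pairing with \<open>b\<close>. So \<open>v'\<close> lies
      in the radical of \<open>P + w\<close> on \<open>U\<close>.\<close>
    define v' where "v' = v - scale (w v b) x"
    have vU: "v \<in> U" using v(1) U'U by auto
    have "v' = 0"
    proof (rule nondegenerate_onD[OF nd[OF wW]])
      show "v' \<in> U" using vU x U by (simp add: v'_def subspace_diff subspace_scale)
      fix y assume y: "y \<in> U"
      define y' where "y' = y + scale (P b y) x - scale (P x y) b"
      have y': "y' \<in> U'" unfolding y'_def by (rule hyp(2)[OF y])
      have wvx: "w v x = 0" using wx[OF vU] alternating_form_swap[OF alt[OF wW], of v x] by simp
      have Pvx: "P v x = 0" "P v b = 0"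
        using v(1) alternating_form_swap[OF P, of v] by (auto simp: U'_def)
      have "P x y' = 0" "w x y' = 0" using y' wx by (auto simp: U'_def)
      moreover have "P v y' + w v y' = 0" using v(2) y' by simp
      moreover have "y = y' - scale (P b y) x + scale (P x y) b" by (simp add: y'_def)
      then have "(P + w) v' y = (P + w) v' (y' - scale (P b y) x + scale (P x y) b)" by simp
      ultimately show "(P + w) v' y = 0"
        by (simp add: v'_def alternating_formD[OF P] aw wvx Pvx Pxb wx[OF b] algebra_simps)
    qed
    then have veq: "v = scale (w v b) x" by (simp add: v'_def)
    have "P b v = 0" using v(1) by (simp add: U'_def)
    then have "w v b = 0" by (subst (asm) veq) (simp add: alternating_formD[OF P] Pbx)
    then show "v = 0" using veq by simp
  qed
  have ndPU': "nondegenerate_on U' P"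
    using ndU'[OF forms.subspace_0[OF sW']] by simp
  obtain E where E: "finite E" "card E \<le> n * (n - 1)"
    "\<And>w. w \<in> W' \<Longrightarrow> (\<forall>(p, q)\<in>E. w p q = 0) \<Longrightarrow> (\<forall>u\<in>U'. \<forall>v\<in>U'. w u v = 0)"
  proof -
    have "infinite (UNIV :: 'a set) \<or> 2 * n - 1 \<le> card (UNIV :: 'a set)"
      using Suc.prems(1) by auto
    moreover have "W' \<subseteq> alt_forms scale" using Suc.prems(5) by (auto simp: W'_def)
    ultimately show ?thesis using Suc.IH[OF _ P hyp(1) dimU' _ sW' ndU'] that by blast
  qed
  define wedge where "wedge y w \<longleftrightarrow> (\<forall>u\<in>U. \<forall>v\<in>U. w u v = P x u * P y v - P y u * P x v)" for y w
  \<comment> \<open>These wedges are the forms that evaluation at \<open>x\<close> and on pairs from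
    \<open>U'\<close> cannot detect.\<close>
  define Y where "Y = {y \<in> U'. \<exists>w\<in>W. wedge y w}"
  have sY: "subspace Y"
  proof (rule subspaceI)
    show "0 \<in> Y" using forms.subspace_0[OF sW] subspace_0[OF hyp(1)]
      by (auto simp: Y_def wedge_def alternating_formD[OF P] intro!: bexI[of _ 0])
    fix y y' c assume "y \<in> Y"
    then obtain w where w: "y \<in> U'" "w \<in> W" "wedge y w" by (auto simp: Y_def)
    then have "wedge (scale c y) (form_scale c w)"
      by (auto simp: wedge_def form_scale_def alternating_formD[OF P] right_diff_distrib mult.left_commute)
    then show "scale c y \<in> Y"
      using subspace_scale[OF hyp(1) w(1)] forms.subspace_scale[OF sW w(2)] by (auto simp: Y_def)
    assume "y' \<in> Y"
    then obtain w' where w': "y' \<in> U'" "w' \<in> W" "wedge y' w'" by (auto simp: Y_def)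
    then have "wedge (y + y') (w + w')"
      using w by (auto simp: wedge_def alternating_formD[OF P] distrib_left distrib_right)
    then show "y + y' \<in> Y"
      using subspace_add[OF hyp(1) w(1) w'(1)] forms.subspace_add[OF sW w(2) w'(2)]
      by (auto simp: Y_def)
  qed
  have orth: "w x y = 0" if w: "w \<in> W" and "y \<in> Y" for w y
  proof (cases "y = 0")
    case False
    from \<open>y \<in> Y\<close> obtain w1 where w1: "y \<in> U'" "w1 \<in> W" "wedge y w1" by (auto simp: Y_def)
    obtain d where d: "d \<in> U'" "P y d \<noteq> 0"
      using nondegenerate_onD[OF ndPU' w1(1)] False by blast
    show ?thesis
    proof (rule isotropic_resolvents_imp_orthogonal[OF P alt[OF w] U])
      show "nondegenerate_on U (P + form_scale t w)" for t
        by (intro nd forms.subspace_scale[OF sW] w)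
      show "x \<in> U" "y \<in> U" "P x y = 0" using x w1(1) by (auto simp: U'_def)
      show "b \<in> U" "P b x \<noteq> 0" using b Pbx by auto
      show "d \<in> U" "P d x = 0" "P d y \<noteq> 0"
        using d alternating_form_swap[OF P, of d] by (auto simp: U'_def)
      show "infinite (UNIV :: 'a set) \<or> dim U - 1 \<le> card (UNIV :: 'a set)"
        using Suc.prems(1) dimU by simp
      fix t z assume z: "z \<in> U" "\<And>v. v \<in> U \<Longrightarrow> P z v + t * w z v = P x v"
      have "form_scale t w \<in> W" by (intro forms.subspace_scale[OF sW] w)
      then have aQ: "alternating_form scale (P + form_scale t w)"
        using forms.subspace_add[OF subspace_alt_forms[OF vs], of P] P alt
        by (auto simp: alt_forms_def)
      show "P z y = 0"
      proof (rule wedge_perturbation_isotropic[OF aQ _ _ P z(1)])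
        fix s
        have "form_scale t w + form_scale s w1 \<in> W"
          by (intro forms.subspace_add[OF sW] forms.subspace_scale[OF sW] w w1(2))
        then show "nondegenerate_on U (P + form_scale t w + form_scale s w1)"
          unfolding add.assoc by (rule nd)
      qed (use w1(3) z(2) in \<open>auto simp: wedge_def form_scale_def\<close>)
    qed
  qed (simp add: alternating_formD[OF alt[OF w]])
  obtain B1 where B1: "B1 \<subseteq> Y" "independent B1" "Y \<subseteq> span B1"
    using maximal_independent_subset by metis
  have "B1 \<subseteq> U'" using B1(1) by (auto simp: Y_def)
  then obtain B where B: "B1 \<subseteq> B" "B \<subseteq> U'" "independent B" "U' \<subseteq> span B"
    using maximal_independent_subset_extend[OF _ B1(2)] by metis
  have finB: "finite B" by (rule finiteI_independent[OF B(3)])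
  have finB1: "finite B1" using finB B(1) finite_subset by blast
  have cardB: "card B = 2 * n" using basis_card_eq_dim[OF B(2,4,3)] dimU' by simp
  have spB: "span B = U'" using span_subspace[OF B(2,4) hyp(1)] .
  \<comment> \<open>The vectors \<open>c d\<close> with \<open>d\<close> in \<open>B\<close> form
    the \<open>P\<close>-dual basis, used to read off coordinates.\<close>
  have "\<forall>d. \<exists>c\<in>U'. \<forall>e\<in>B. P c e = (if e = d then 1 else 0)"
    by (intro allI nondegenerate_on_surj_basis[OF P ndPU' B(2,3) spB])
  then obtain c where c: "\<And>d e. e \<in> B \<Longrightarrow> P (c d) e = (if e = d then 1 else 0)" "\<And>d. c d \<in> U'"
    by metis
  \<comment> \<open>The first pairs test \<open>w x\<close> on \<open>U'\<close>, where
    \<open>orth\<close> already covers the part \<open>B1\<close> of the basis; \<open>E\<close>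
    tests the restriction to \<open>U'\<close>; the last pairs test the wedges that remain. The
    first and last kinds together number \<open>card B = 2 * n\<close>.\<close>
  define F where "F = Pair x ` (B - B1) \<union> E \<union> (\<lambda>d. (b, c d)) ` B1"
  have "card F \<le> card (Pair x ` (B - B1)) + card E + card ((\<lambda>d. (b, c d)) ` B1)"
    unfolding F_def by (meson add_right_mono card_Un_le le_trans)
  also have "\<dots> \<le> card (B - B1) + card E + card B1"
    by (intro add_mono card_image_le) (auto simp: finB finB1)
  also have "card (B - B1) + card E + card B1 = card B + card E"
    using card_mono[OF finB B(1)] by (simp add: card_Diff_subset[OF finB1 B(1)])
  finally have cardF: "card F \<le> Suc n * (Suc n - 1)"
    using cardB E(2) by (cases n) (auto simp: algebra_simps)
  show ?case
  proof (intro exI[of _ F] conjI ballI impI)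
    show "finite F" using E(1) finB finB1 by (simp add: F_def)
    show "card F \<le> Suc n * (Suc n - 1)" by (rule cardF)
    fix w u v assume w: "w \<in> W" and F0: "\<forall>(p, q)\<in>F. w p q = 0" and u: "u \<in> U" and v: "v \<in> U"
    note aw = alternating_formD[OF alt[OF w]]
    have dec: "\<exists>v'\<in>U'. v = v' - scale (P b v) x + scale (P x v) b" if "v \<in> U" for v
      using hyp(2)[OF that] by (intro bexI) auto
    have "w x e = 0" if "e \<in> B" for e
    proof (cases "e \<in> B1")
      case True
      then show ?thesis using orth[OF w] B1(1) by auto
    next
      case False
      then show ?thesis using F0 that by (auto simp: F_def)
    qed
    then have wxU': "w x v = 0" if "v \<in> U'" for v
      using linear_eq_on_span[OF alternating_form_linear(2)[OF alt[OF w]]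
          alternating_form_linear(2)[OF alt[OF w]], of v B x 0] that spB
      by (simp add: aw)
    have wxU: "w x v = P x v * w x b" if v: "v \<in> U" for v
    proof -
      obtain v' where v': "v' \<in> U'" "v = v' - scale (P b v) x + scale (P x v) b"
        using dec[OF v] by blast
      show ?thesis by (subst v'(2)) (simp add: aw wxU'[OF v'(1)])
    qed
    \<comment> \<open>On \<open>U\<close>, \<open>w x\<close> is now \<open>w x b\<close> times
      \<open>P x\<close>. A nonzero factor would put \<open>x\<close> into the radical of
      \<open>P - w / (w x b)\<close>, a form of the affine space. This is why \<open>F\<close> can
      omit the pair \<open>(x, b)\<close>.\<close>
    have "w x b = 0"
    proof (rule ccontr)
      assume nz: "w x b \<noteq> 0"
      have "x = 0"
        by (rule nondegenerate_onD[OF nd[OF forms.subspace_scale[OF sW w, of "- 1 / w x b"]] x(1)])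
          (simp add: form_scale_def wxU nz)
      with x show False by simp
    qed
    then have wx: "w x v = 0" if "v \<in> U" for v using wxU that by simp
    then have "w \<in> W'" using w by (simp add: W'_def)
    then have wU': "w u v = 0" if "u \<in> U'" "v \<in> U'" for u v
      using E(3) F0 that by (auto simp: F_def)
    \<comment> \<open>Only the values of \<open>w b\<close> on \<open>U'\<close> are still
      undetermined; the vector \<open>y\<close> representing them through \<open>P\<close> exhibits
      \<open>w\<close> as a wedge.\<close>
    obtain y where y: "y \<in> U'" "\<And>v. v \<in> U' \<Longrightarrow> P y v = w b v"
      using nondegenerate_on_surj[OF P ndPU' hyp(1) alternating_form_linear(2)[OF alt[OF w]]] by blast
    have Py: "P y x = 0" "P y b = 0"
      using y(1) alternating_form_swap[OF P, of y] by (auto simp: U'_def)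
    have w_eq: "w u v = P x u * P y v - P y u * P x v" if u: "u \<in> U" and v: "v \<in> U" for u v
    proof -
      obtain u' where u': "u' \<in> U'" "u = u' - scale (P b u) x + scale (P x u) b"
        using dec[OF u] by blast
      obtain v' where v': "v' \<in> U'" "v = v' - scale (P b v) x + scale (P x v) b"
        using dec[OF v] by blast
      have sw: "w r x = 0" if "r \<in> U" for r
        using wx[OF that] alternating_form_swap[OF alt[OF w], of r x] by simp
      have "w u v = w (u' - scale (P b u) x + scale (P x u) b) (v' - scale (P b v) x + scale (P x v) b)"
        using u'(2) v'(2) by simp
      also have "\<dots> = P x v * w u' b + P x u * w b v'"
        using u'(1) v'(1) U'U b x by (simp add: aw wx sw wU' subset_iff)
      also have "w u' b = - P y u'"
        using alternating_form_swap[OF alt[OF w], of u' b] y(2)[OF u'(1)] by simp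
      also have "w b v' = P y v'" using y(2)[OF v'(1)] by simp
      also have "P y u' = P y u" by (subst u'(2)) (simp add: alternating_formD[OF P] Py)
      also have "P y v' = P y v" by (subst v'(2)) (simp add: alternating_formD[OF P] Py)
      finally show ?thesis by simp
    qed
    then have "y \<in> Y" using y(1) w by (auto simp: Y_def wedge_def)
    then obtain r where r: "y = (\<Sum>e\<in>B1. scale (r e) e)"
      using B1(3) span_finite[OF finB1] by auto
    have "r d = 0" if d: "d \<in> B1" for d
    proof -
      have "P (c d) y = (\<Sum>e\<in>B1. r e * (if e = d then 1 else 0))"
        unfolding r alternating_formD[OF P] using B(1) by (intro sum.cong) (auto simp: c)
      also have "\<dots> = r d" using d finB1 by (simp add: if_distrib cong: if_cong)
      finally have "r d = P (c d) y" ..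
      also have "\<dots> = - w b (c d)"
        using y(2)[OF c(2)] alternating_form_swap[OF P, of "c d" y] by simp
      also have "\<dots> = 0" using F0 d by (auto simp: F_def)
      finally show ?thesis .
    qed
    then have "y = 0" by (simp add: r)
    then show "w u v = 0" using w_eq[OF u v] by (simp add: alternating_formD[OF P])
  qed
qed

section \<open>The extremal example\<close>

text \<open>For \<open>q = n + k\<close> the index \<open>p\<close> runs through
  \<open>{2 * n - q..<q}\<close>, which has \<open>2 * k\<close> elements; these even numbers are
  summed over \<open>k < n\<close>.\<close>

lemma card_upper_pairs_beyond_antidiagonal:
  "card {(p, q). p < q \<and> q < 2 * n \<and> 2 * n \<le> p + q} = n * (n - 1 :: nat)"
proof -
  have "{(p, q). p < q \<and> q < 2 * n \<and> 2 * n \<le> p + q} =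
      prod.swap ` (SIGMA q:{n<..<2 * n}. {2 * n - q..<q})"
    by (auto simp: image_iff)
  then have "card {(p, q). p < q \<and> q < 2 * n \<and> 2 * n \<le> p + q} =
      (\<Sum>q\<in>{n<..<2 * n}. q - (2 * n - q))"
    by (simp add: card_image)
  also have "\<dots> = (\<Sum>k\<in>{1..<n}. 2 * k)"
    by (rule sum.reindex_bij_witness[of _ "\<lambda>k. n + k" "\<lambda>q. q - n"]) auto
  also have "\<dots> = n * (n - 1)"
    by (induction n) (auto simp: algebra_simps)
  finally show ?thesis .
qed

text \<open>With indices starting at \<open>0\<close>, the antidiagonal is
  \<open>i + j = 2 * n - 1\<close>. The wedges of coordinate functionals indexed strictly beyond it
  span \<open>W\<close>, so adding an element of \<open>W\<close> to \<open>b\<close> changes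
  neither the zeros before it nor the nonzero entries on it.\<close>

lemma symplectic_affine_space_exists:
  assumes "dim UNIV = 2 * n"
  shows "\<exists>S. affine_subspace_of_dim scale S (n * (n - 1)) \<and> S \<subseteq> {b. symplectic_form scale b}"
proof -
  have vs: "vector_space scale" by unfold_locales
  obtain B where B: "finite B" "independent B" "span B = UNIV" "card B = 2 * n"
    using basis_subspace_exists[OF subspace_UNIV] assms by metis
  obtain e where e: "bij_betw e {..<2 * n} B"
    using ex_bij_betw_nat_finite[OF B(1)] B(4) by (auto simp: atLeast0LessThan)
  have eB: "e i \<in> B" if "i < 2 * n" for i using e that by (auto simp: bij_betw_def)
  define X where "X i v = representation B v (e i)" for i v
  have X: "X i (u + v) = X i u + X i v" "X i (scale c v) = c * X i v" for i u v c
    using B(2,3) by (simp_all add: X_def representation_add representation_scale)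
  have Xe: "X i (e j) = (if i = j then 1 else 0)" if "i < 2 * n" "j < 2 * n" for i j
    using that e eB[of j] B(2) by (auto simp: X_def representation_basis bij_betw_def inj_on_def)
  have expand: "v = (\<Sum>i<2 * n. scale (X i v) (e i))" for v
  proof -
    have "(\<Sum>i<2 * n. scale (X i v) (e i)) = (\<Sum>d\<in>B. scale (representation B v d) d)"
      unfolding X_def by (rule sum.reindex_bij_betw[OF e])
    then show ?thesis
      using sum_representation_eq[OF B(2) _ B(1) subset_refl, of v] B(3) by simp
  qed
  define D where "D p q u v = X p u * X q v - X q u * X p v" for p q u v
  have altD: "alternating_form scale (D p q)" for p q
    by (rule alternating_formI[OF vs]) (auto simp: D_def X algebra_simps)
  define I where "I = {(p, q). p < q \<and> q < 2 * n \<and> 2 * n \<le> p + q}"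
  have "I \<subseteq> {..<2 * n} \<times> {..<2 * n}" by (auto simp: I_def)
  then have finI: "finite I" by (rule finite_subset) simp
  define G where "G = (\<lambda>(p, q). D p q)"
  have Ge: "G r (e (fst s)) (e (snd s)) = (if r = s then 1 else 0)" if "r \<in> I" "s \<in> I" for r s
    using that by (auto simp: G_def D_def I_def Xe split: if_splits)
  have inj: "inj_on G I"
    by (rule inj_onI) (metis Ge zero_neq_one)
  have indep: "forms.independent (G ` I)"
  proof (rule forms.independent_if_scalars_zero)
    fix f g assume f: "(\<Sum>g\<in>G ` I. form_scale (f g) g) = 0" and "g \<in> G ` I"
    then obtain s where s: "s \<in> I" "g = G s" by blast
    have "0 = (\<Sum>g\<in>G ` I. form_scale (f g) g) (e (fst s)) (e (snd s))" using f by simp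
    also have "\<dots> = (\<Sum>r\<in>I. f (G r) * G r (e (fst s)) (e (snd s)))"
      by (simp add: sum.reindex[OF inj] sum_form_apply form_scale_def)
    also have "\<dots> = (\<Sum>r\<in>I. f (G r) * (if r = s then 1 else 0))"
      using s(1) by (intro sum.cong) (auto simp: Ge)
    also have "\<dots> = f g" using s finI by (simp add: if_distrib cong: if_cong)
    finally show "f g = 0" ..
  qed (use finI in simp)
  have dimW: "forms.dim (forms.span (G ` I)) = n * (n - 1)"
    unfolding forms.dim_span_eq_card_independent[OF indep] card_image[OF inj]
    by (simp only: I_def card_upper_pairs_beyond_antidiagonal)
  define W where "W = forms.span (G ` I)"
  have "W \<subseteq> alt_forms scale"
    unfolding W_def by (rule forms.span_minimal[OF _ subspace_alt_forms[OF vs]])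
      (auto simp: G_def alt_forms_def altD)
  have W0: "W \<subseteq> {w. \<forall>i j. i + j < 2 * n \<longrightarrow> w (e i) (e j) = 0}"
    unfolding W_def
  proof (rule forms.span_minimal)
    show "G ` I \<subseteq> {w. \<forall>i j. i + j < 2 * n \<longrightarrow> w (e i) (e j) = 0}"
      by (auto simp: G_def D_def I_def Xe)
  qed (auto simp: forms.subspace_def form_scale_def)
  define b where "b u v = (\<Sum>p<n. D p (2 * n - 1 - p) u v)" for u v
  have altb: "alternating_form scale b"
    by (rule alternating_formI[OF vs])
      (simp_all add: b_def alternating_formD[OF altD] sum.distrib sum_distrib_left)
  have b0: "b (e i) (e j) = 0" if "i + j < 2 * n - 1" for i j
    unfolding b_def by (rule sum.neutral) (use that in \<open>auto simp: D_def Xe\<close>)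
  have b1: "b (e i) (e j) \<noteq> 0" if "i + j = 2 * n - 1" "j < 2 * n" for i j
  proof -
    have i: "i < 2 * n" using that by simp
    have "b (e i) (e j) = (\<Sum>p<n. (if p = i then 1 else 0) - (if p = j then 1 else 0))"
      unfolding b_def by (rule sum.cong) (use that i in \<open>auto simp: D_def Xe\<close>)
    \<comment> \<open>Exactly one of \<open>i\<close> and \<open>j\<close> is below
      \<open>n\<close>, so the entry is \<open>1\<close> or \<open>- 1\<close>, nonzero in every
      characteristic.\<close>
    also have "\<dots> = (if i < n then 1 else 0) - (if j < n then 1 else 0)"
      by (simp add: sum_subtractf)
    finally show ?thesis using that by auto
  qed
  have "symplectic_form scale (b + w)" if w: "w \<in> W" for w
  proof -
    define c where "c = b + w"
    have altw: "alternating_form scale w" using \<open>W \<subseteq> alt_forms scale\<close> w by (auto simp: alt_forms_def)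
    have altc: "alternating_form scale c"
      unfolding c_def using forms.subspace_add[OF subspace_alt_forms[OF vs], of b w] altb altw
      by (auto simp: alt_forms_def)
    have c0: "c (e i) (e j) = 0" if "i + j < 2 * n - 1" for i j
      using b0[OF that] W0 w that by (auto simp: c_def)
    have c1: "c (e i) (e j) \<noteq> 0" if "i + j = 2 * n - 1" "j < 2 * n" for i j
      using b1[OF that] W0 w that by (auto simp: c_def)
    have "u = 0" if u: "\<forall>v. c u v = 0" for u
    proof -
      \<comment> \<open>Back substitution from the last coordinate downwards: column
        \<open>j\<close> of the Gram matrix involves only coordinates with index at least
        \<open>2 * n - 1 - j\<close>, and the larger ones are already zero.\<close>
      have X0: "X (2 * n - 1 - j) u = 0" if "j < 2 * n" for j
        using that
      proof (induction j rule: less_induct)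
        case (less j)
        have "0 = c (\<Sum>i<2 * n. scale (X i u) (e i)) (e j)" using u expand[of u] by simp
        also have "\<dots> = (\<Sum>i<2 * n. X i u * c (e i) (e j))"
          by (simp add: alternating_formD[OF altc])
        also have "\<dots> = (\<Sum>i\<in>{2 * n - 1 - j}. X i u * c (e i) (e j))"
        proof (rule sum.mono_neutral_right)
          show "\<forall>i\<in>{..<2 * n} - {2 * n - 1 - j}. X i u * c (e i) (e j) = 0"
          proof
            fix i assume i: "i \<in> {..<2 * n} - {2 * n - 1 - j}"
            show "X i u * c (e i) (e j) = 0"
            proof (cases "i + j < 2 * n - 1")
              case False
              then have "2 * n - 1 - i < j" using i less.prems by auto
              then have "X (2 * n - 1 - (2 * n - 1 - i)) u = 0" using less by simp
              moreover have "2 * n - 1 - (2 * n - 1 - i) = i" using i by auto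
              ultimately show ?thesis by simp
            qed (simp add: c0)
          qed
        qed (use less.prems in auto)
        finally show ?case using c1[of "2 * n - 1 - j" j] less.prems by simp
      qed
      have "X i u = 0" if "i < 2 * n" for i
      proof -
        have "2 * n - 1 - (2 * n - 1 - i) = i" using that by simp
        then show ?thesis using X0[of "2 * n - 1 - i"] that by simp
      qed
      then have "(\<Sum>i<2 * n. scale (X i u) (e i)) = 0" by simp
      then show "u = 0" using expand[of u] by simp
    qed
    then show ?thesis using altc by (simp add: symplectic_form_def c_def)
  qed
  moreover have "affine_subspace_of_dim scale ((\<lambda>w. b + w) ` W) (n * (n - 1))"
    unfolding affine_subspace_of_dim_def
    using altb \<open>W \<subseteq> alt_forms scale\<close> dimW
    by (intro exI[of _ b] exI[of _ W]) (auto simp: W_def alt_forms_def)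
  ultimately show ?thesis by blast
qed

section \<open>The upper bound for dimensions\<close>

text \<open>For \<open>U = UNIV\<close> the evaluations at the pairs in \<open>E\<close> are linear
  functionals that separate the points of \<open>W\<close>, so their number bounds its
  dimension.\<close>

lemma symplectic_affine_space_dim_le:
  assumes field: "infinite (UNIV :: 'a set) \<or> 2 * n - 1 \<le> card (UNIV :: 'a set)"
    and dim: "dim UNIV = 2 * n"
    and S: "affine_subspace_of_dim scale S d" "S \<subseteq> {b. symplectic_form scale b}"
  shows "d \<le> n * (n - 1)"
proof -
  obtain P W where PW: "alternating_form scale P" "W \<subseteq> alt_forms scale" "forms.subspace W"
    "S = (\<lambda>w. P + w) ` W" "forms.dim W = d"
    using S(1) by (auto simp: affine_subspace_of_dim_def alt_forms_def)
  have "nondegenerate_on UNIV (P + w)" if "w \<in> W" for w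
    using S(2) that by (auto simp: PW(4) symplectic_form_def nondegenerate_on_def)
  then obtain E where E: "finite E" "card E \<le> n * (n - 1)"
    "\<And>w. w \<in> W \<Longrightarrow> (\<forall>(p, q)\<in>E. w p q = 0) \<Longrightarrow> (\<forall>u v. w u v = 0)"
    using symplectic_affine_space_separating_pairs[OF field PW(1) subspace_UNIV dim PW(2,3)] by auto
  have vs: "vector_space ((*) :: 'a \<Rightarrow> 'a \<Rightarrow> 'a)" by unfold_locales (auto simp: algebra_simps)
  have "forms.dim W \<le> card E"
  proof (rule forms.dim_le_card_separating[OF E(1) _ PW(3)])
    show "Vector_Spaces.linear form_scale (*) (\<lambda>w :: 'b \<Rightarrow> 'b \<Rightarrow> 'a. w (fst r) (snd r))" for r :: "'b \<times> 'b"
      using vs by (auto simp: Vector_Spaces.linear_iff form_scale_def intro: forms.vector_space_axioms)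
    show "w = 0" if "w \<in> W" "\<And>r. r \<in> E \<Longrightarrow> w (fst r) (snd r) = 0" for w
    proof -
      have "\<forall>(p, q)\<in>E. w p q = 0" using that(2) by force
      then show ?thesis using E(3)[OF that(1)] by (simp add: fun_eq_iff)
    qed
  qed
  with E(2) PW(5) show ?thesis by simp
qed

end

theorem theorem3:
  fixes scale :: "'a::field \<Rightarrow> 'b::ab_group_add \<Rightarrow> 'b" and n :: nat
  assumes "infinite (UNIV :: 'a set) \<or> card (UNIV :: 'a set) \<ge> 2 * n - 1"
    and "vector_space scale"
    and "\<exists>B. finite_dimensional_vector_space scale B"
    and "vector_space.dim scale (UNIV :: 'b set) = 2 * n"
  shows "(\<exists>S. affine_subspace_of_dim scale S (n * (n - 1)) \<and> S \<subseteq> {b. symplectic_form scale b})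
       \<and> (\<forall>S d. affine_subspace_of_dim scale S d \<and> S \<subseteq> {b. symplectic_form scale b}
                \<longrightarrow> d \<le> n * (n - 1))"
proof -
  obtain B where "finite_dimensional_vector_space scale B" using assms(3) by blast
  then interpret finite_dimensional_vector_space scale B .
  show ?thesis
    using symplectic_affine_space_exists[OF assms(4)]
      symplectic_affine_space_dim_le[OF assms(1,4)] by blast
qed

end
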